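(* Let $n \geq 1$, let $A = \{a_1,\dots,a_n\}$ be a multiset of positive integers with $a_1 \geq a_2 \geq \dots \geq a_n$, and let $P = \{1,2,\dots,2n\}$, i.e. $p_i = i$ for $1 \le i \le 2n$. Then the two conditions (parity and density) necessary for $P$ to be partitioned into the differences in $A$ reduce to the following: (1) the parity condition $\sum_{i=1}^n a_i \equiv \sum_{i=1}^{2n} p_i \pmod 2$ holds if and only if the number of indices $i$ with $a_i$ even is even; (2) the density condition $\sum_{i=1}^m a_i \leq \left(\sum_{i=2n+1-m}^{2n} p_i\right) - \left(\sum_{i=1}^m p_i\right)$ for all $1 \le m \le n$ holds if and only if $\sum_{i=1}^m a_i \leq m(2n-m)$ for each $1 \leq m \leq n$.
   Context: "$P$ can be partitioned into the differences in $A$" means that the set $P$ can be partitioned into $n$ two-element subsets $\{s_i,t_i\}$, $i=1,\dots,n$, with $s_i - t_i = a_i$ for each $i$. *)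

theory Defs
  imports "HOL-Number_Theory.Cong" "HOL-Library.Disjoint_Sets"
begin

(* A multiset of n integers is given by an enumeration a 1, ..., a n; values of a outside
   {1..n} are irrelevant.  Likewise p 1, ..., p (2 * n) lists the elements of a set of
   2 * n integers in increasing order. *)

definition partitionable_into_differences :: "int set \<Rightarrow> nat \<Rightarrow> (nat \<Rightarrow> int) \<Rightarrow> bool" where
  "partitionable_into_differences P n a \<longleftrightarrow>
     (\<exists>s t. (\<forall>i\<in>{1..n}. s i \<noteq> t i \<and> s i - t i = a i) \<and>
            disjoint_family_on (\<lambda>i. {s i, t i}) {1..n} \<and>
            (\<Union>i\<in>{1..n}. {s i, t i}) = P)"

definition parity_condition :: "nat \<Rightarrow> (nat \<Rightarrow> int) \<Rightarrow> (nat \<Rightarrow> int) \<Rightarrow> bool" where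
  "parity_condition n a p \<longleftrightarrow> [(\<Sum>i=1..n. a i) = (\<Sum>i=1..2*n. p i)] (mod 2)"

definition density_condition :: "nat \<Rightarrow> (nat \<Rightarrow> int) \<Rightarrow> (nat \<Rightarrow> int) \<Rightarrow> bool" where
  "density_condition n a p \<longleftrightarrow>
     (\<forall>m\<in>{1..n}. (\<Sum>i=1..m. a i) \<le> (\<Sum>i=2*n+1-m..2*n. p i) - (\<Sum>i=1..m. p i))"

end

theory Submission
  imports Defs
begin

text \<open>
  For the set \<open>{1..2n}\<close> both conditions have closed forms. The right-hand side of the
  parity condition is \<open>n(2n+1)\<close>, which has the parity of \<open>n\<close>, while the sum of the \<open>a i\<close> has
  the parity of the number of odd terms; the two agree exactly when the number of remaining,
  even terms is even. In the density condition, the \<open>m\<close> largest elements of \<open>{1..2n}\<close> are the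
  translates by \<open>2n - m\<close> of the \<open>m\<close> smallest, so the right-hand side is \<open>m(2n - m)\<close>.

  Both conditions are necessary for a partition into pairs \<open>{s i, t i}\<close> with difference
  \<open>a i\<close>. Each pair contributes \<open>s i + t i = a i + 2 t i\<close> to the sum of \<open>{1..2n}\<close>, which gives
  the parity condition. The sum of the first \<open>m\<close> differences is the difference of the sums of
  two \<open>m\<close>-element subsets of \<open>{1..2n}\<close>; such a difference is largest for the \<open>m\<close> largest and
  the \<open>m\<close> smallest elements (lemma \<open>sum_diff_subsets_le\<close>), where it equals \<open>m(2n - m)\<close>.
\<close>

lemma double_sum_atLeast_one_ge:
  fixes T :: "int set"
  assumes "finite T" "\<And>x. x \<in> T \<Longrightarrow> 1 \<le> x"
  shows "int (card T) * (int (card T) + 1) \<le> 2 * \<Sum>T"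
  using assms
proof (induction T rule: finite_linorder_max_induct)
  case (insert b T)
  have "T \<subseteq> {1..<b}"
    using insert by auto
  then have "card T \<le> card {1..<b}"
    by (intro card_mono) auto
  moreover have "1 \<le> b"
    using insert.prems by simp
  \<comment> \<open>All smaller elements lie in \<open>{1..<b}\<close>, so the maximum \<open>b\<close> exceeds their number.\<close>
  ultimately have "int (card T) + 1 \<le> b"
    by simp
  moreover have "b \<notin> T"
    using insert.hyps by auto
  moreover have "int (card T) * (int (card T) + 1) \<le> 2 * \<Sum>T"
    using insert by simp
  ultimately show ?case
    using insert.hyps by (simp add: algebra_simps)
qed simp

text \<open>The reflection \<open>x \<mapsto> N + 1 - x\<close> turns the lower bound into the upper bound.\<close>

lemma double_sum_atMost_le:
  fixes S :: "int set"
  assumes "finite S" "\<And>x. x \<in> S \<Longrightarrow> x \<le> N"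
  shows "2 * \<Sum>S \<le> int (card S) * (2 * N + 1 - int (card S))"
proof -
  let ?r = "\<lambda>x. N + 1 - x"
  have inj: "inj_on ?r S"
    by (auto intro: inj_onI)
  have "int (card (?r ` S)) * (int (card (?r ` S)) + 1) \<le> 2 * \<Sum>(?r ` S)"
    using assms by (intro double_sum_atLeast_one_ge) auto
  moreover have "\<Sum>(?r ` S) = int (card S) * (N + 1) - \<Sum>S"
    using inj by (simp add: sum.reindex sum_subtractf)
  ultimately show ?thesis
    using inj by (simp add: card_image algebra_simps)
qed

lemma sum_diff_subsets_le:
  fixes S T :: "int set"
  assumes "S \<subseteq> {1..N}" "T \<subseteq> {1..N}" "card S = m" "card T = m"
  shows "\<Sum>S - \<Sum>T \<le> int m * (N - int m)"
proof -
  have "2 * \<Sum>S \<le> int (card S) * (2 * N + 1 - int (card S))"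
    using assms(1) by (intro double_sum_atMost_le) (auto intro: finite_subset)
  moreover have "int (card T) * (int (card T) + 1) \<le> 2 * \<Sum>T"
    using assms(2) by (intro double_sum_atLeast_one_ge) (auto intro: finite_subset)
  ultimately show ?thesis
    using assms by (simp add: algebra_simps)
qed

lemma parity_condition_iff:
  assumes "\<And>i. i \<in> {1..2*n} \<Longrightarrow> p i = int i"
  shows "parity_condition n a p \<longleftrightarrow> even (card {i \<in> {1..n}. even (a i)})"
proof -
  have "(\<Sum>i=1..2*n. p i) = int (\<Sum>i=1..2*n. i)"
    using assms by simp
  also have "(\<Sum>i=1..2*n. i) = n * (2 * n + 1)"
    using gauss_sum_from_Suc_0[of "2*n", where 'a=nat] by simp
  finally have p: "even (\<Sum>i=1..2*n. p i) \<longleftrightarrow> even n"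
    by simp
  have "card {1..n} = card ({i \<in> {1..n}. even (a i)} \<union> {i \<in> {1..n}. odd (a i)})"
    by (rule arg_cong[of _ _ card]) auto
  also have "\<dots> = card {i \<in> {1..n}. even (a i)} + card {i \<in> {1..n}. odd (a i)}"
    by (intro card_Un_disjoint) auto
  finally have "even (card {1..n}) \<longleftrightarrow>
      even (card {i \<in> {1..n}. even (a i)} + card {i \<in> {1..n}. odd (a i)})"
    by (rule arg_cong)
  moreover have "even (\<Sum>i=1..n. a i) \<longleftrightarrow> even (card {i \<in> {1..n}. odd (a i)})"
    by (simp add: even_sum_iff)
  ultimately show ?thesis
    using p by (auto simp: parity_condition_def cong_iff_dvd_diff)
qed

lemma density_condition_iff:
  assumes "\<And>i. i \<in> {1..2*n} \<Longrightarrow> p i = int i"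
  shows "density_condition n a p \<longleftrightarrow>
    (\<forall>m\<in>{1..n}. (\<Sum>i=1..m. a i) \<le> int m * (2 * int n - int m))"
proof -
  have "(\<Sum>i=2*n+1-m..2*n. p i) - (\<Sum>i=1..m. p i) = int m * (2 * int n - int m)"
    if "m \<in> {1..n}" for m
  proof -
    have "(\<Sum>i=2*n+1-m..2*n. p i) = (\<Sum>i=1+(2*n-m)..m+(2*n-m). p i)"
      using that by (intro sum.cong) auto
    also have "\<dots> = (\<Sum>i=1..m. p (i + (2*n-m)))"
      by (rule sum.shift_bounds_cl_nat_ivl)
    also have "\<dots> = (\<Sum>i=1..m. p i + (2 * int n - int m))"
    proof (rule sum.cong)
      fix i assume "i \<in> {1..m}"
      then have "i \<in> {1..2*n}" "i + (2*n-m) \<in> {1..2*n}"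
        using that by auto
      then show "p (i + (2*n-m)) = p i + (2 * int n - int m)"
        using that by (simp only: assms) auto
    qed simp
    finally show ?thesis
      by (simp add: sum.distrib)
  qed
  then show ?thesis
    by (simp add: density_condition_def)
qed

lemma sum_cong_if_partitionable:
  assumes "partitionable_into_differences P n a"
  shows "[(\<Sum>i=1..n. a i) = \<Sum>P] (mod 2)"
proof -
  obtain s t where st: "\<forall>i\<in>{1..n}. s i \<noteq> t i \<and> s i - t i = a i"
    and disj: "disjoint_family_on (\<lambda>i. {s i, t i}) {1..n}"
    and P: "(\<Union>i\<in>{1..n}. {s i, t i}) = P"
    using assms unfolding partitionable_into_differences_def by (elim exE conjE)
  have "\<Sum>P = (\<Sum>i=1..n. \<Sum>{s i, t i})"
    unfolding P[symmetric] using disj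
    by (intro sum.UNION_disjoint) (auto simp: disjoint_family_on_def)
  also have "\<dots> = (\<Sum>i=1..n. a i + 2 * t i)"
  proof (rule sum.cong)
    fix i assume "i \<in> {1..n}"
    with st have "s i \<noteq> t i" "s i - t i = a i"
      by blast+
    then show "\<Sum>{s i, t i} = a i + 2 * t i"
      by simp
  qed simp
  finally show ?thesis
    by (simp add: sum.distrib sum_distrib_left[symmetric] cong_iff_dvd_diff)
qed

lemma sum_le_if_partitionable:
  assumes "partitionable_into_differences {1..N} n a" "M \<subseteq> {1..n}"
  shows "sum a M \<le> int (card M) * (N - int (card M))"
proof -
  obtain s t where st: "\<forall>i\<in>{1..n}. s i \<noteq> t i \<and> s i - t i = a i"
    and disj: "disjoint_family_on (\<lambda>i. {s i, t i}) {1..n}"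
    and P: "(\<Union>i\<in>{1..n}. {s i, t i}) = {1..N}"
    using assms unfolding partitionable_into_differences_def by (elim exE conjE)
  have "i = j" if "i \<in> M" "j \<in> M" "{s i, t i} \<inter> {s j, t j} \<noteq> {}" for i j
    using disjoint_family_onD[OF disj, of i j] that assms(2) by blast
  then have inj: "inj_on s M" "inj_on t M"
    by (simp_all add: inj_on_def)
  have "s ` M \<subseteq> {1..N}" "t ` M \<subseteq> {1..N}"
    unfolding P[symmetric] using assms(2) by auto
  then have "\<Sum>(s ` M) - \<Sum>(t ` M) \<le> int (card M) * (N - int (card M))"
    using inj by (intro sum_diff_subsets_le) (auto simp: card_image)
  moreover have "sum a M = (\<Sum>i\<in>M. s i - t i)"
    using st assms(2) by (intro sum.cong) auto
  ultimately show ?thesis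
    using inj by (simp add: sum.reindex sum_subtractf)
qed

theorem corollary7:
  fixes n :: nat and a p :: "nat \<Rightarrow> int" and P :: "int set"
  assumes "n \<ge> 1"
    and "\<And>i. i \<in> {1..n} \<Longrightarrow> a i > 0"
    and "\<And>i j. i \<in> {1..n} \<Longrightarrow> j \<in> {1..n} \<Longrightarrow> i \<le> j \<Longrightarrow> a i \<ge> a j"
    and "P = {1..2 * int n}"
    and "\<And>i. i \<in> {1..2*n} \<Longrightarrow> p i = int i"
  shows "(partitionable_into_differences P n a \<longrightarrow>
            parity_condition n a p \<and> density_condition n a p) \<and>
         (parity_condition n a p \<longleftrightarrow> even (card {i \<in> {1..n}. even (a i)})) \<and>
         (density_condition n a p \<longleftrightarrow>
            (\<forall>m\<in>{1..n}. (\<Sum>i=1..m. a i) \<le> int m * (2 * int n - int m)))"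
proof (intro conjI impI)
  show "parity_condition n a p \<longleftrightarrow> even (card {i \<in> {1..n}. even (a i)})"
    using assms(5) by (rule parity_condition_iff)
  show density: "density_condition n a p \<longleftrightarrow>
      (\<forall>m\<in>{1..n}. (\<Sum>i=1..m. a i) \<le> int m * (2 * int n - int m))"
    using assms(5) by (rule density_condition_iff)
  assume part: "partitionable_into_differences P n a"
  have "P = int ` {1..2*n}"
    using assms(4) by (simp add: image_int_atLeastAtMost)
  then have "\<Sum>P = (\<Sum>i=1..2*n. p i)"
    using assms(5) by (simp add: sum.reindex)
  then show "parity_condition n a p"
    using sum_cong_if_partitionable[OF part] by (simp add: parity_condition_def)
  have "(\<Sum>i=1..m. a i) \<le> int m * (2 * int n - int m)" if "m \<in> {1..n}" for m
    using sum_le_if_partitionable[of "2 * int n" n a "{1..m}"] part assms(4) that by simp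
  then show "density_condition n a p"
    using density by blast
qed

end
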